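(* Let $n\ge 1$ be an integer and let $s(m)=0$ if $m$ is even and $s(m)=*$ if $m$ is odd. The canonical form of \textsc{Snort} played on the (untinted) caterpillar $C(n+1,n,n+1)$ is \[\pm \Big\{\, 2n+1+s(n),\ \big\{ \{ 3n+2 \mid 2n+2+s(n-1) \} \ \big|\ s(n) \big\} \,\Big\},\] i.e. the game whose Left options are $2n+1+s(n)$ and $\big\{ \{ 3n+2 \mid 2n+2+s(n-1) \} \mid s(n) \big\}$ and whose Right options are the negatives of these.
   Context: \textsc{Snort} is a two-player normal-play combinatorial game (the player unable to move loses) between Left (blue) and Right (red), played on a finite simple graph; players alternately colour an uncoloured vertex in their own colour, and a player may not colour a vertex adjacent to a vertex coloured by the opponent. Game values are in the standard sense of combinatorial game theory: $\{A\mid B\}$ is the game with Left options $A$ and Right options $B$, $*=\{0\mid 0\}$, integers are the usual integer games, $\pm\{A,B\}$ denotes $\{A,B\mid -A,-B\}$, and the canonical form is the unique simplest game equal to the given one (no dominated or reversible options). The caterpillar $C(n+1,n,n+1)$ has vertex set $\{a,b,c,a_1,\dots,a_{n+1},b_1,\dots,b_n,c_1,\dots,c_{n+1}\}$ and edge set $\{ab,bc\}\cup\{a_ia, c_ic : 1\le i\le n+1\}\cup\{b_jb : 1\le j\le n\}$. *)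

theory Defs
  imports Main
begin

datatype game = Game "game list" "game list"

fun lopts :: "game \<Rightarrow> game list" where "lopts (Game L R) = L"
fun ropts :: "game \<Rightarrow> game list" where "ropts (Game L R) = R"

lemma size_lopt[termination_simp]: "x \<in> set L \<Longrightarrow> size x < size (Game L R)"
  by (induction L) auto
lemma size_ropt[termination_simp]: "x \<in> set R \<Longrightarrow> size x < size (Game L R)"
  by (induction R) auto

function game_le :: "game \<Rightarrow> game \<Rightarrow> bool" where
  "game_le (Game GL GR) (Game HL HR) =
     ((\<forall>g\<in>set GL. \<not> game_le (Game HL HR) g) \<and> (\<forall>h\<in>set HR. \<not> game_le h (Game GL GR)))"
  by pat_completeness auto
termination
  by (relation "measure (\<lambda>(x,y). size x + size y)") (auto dest: size_lopt size_ropt)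

definition game_eq :: "game \<Rightarrow> game \<Rightarrow> bool" where
  "game_eq G H \<longleftrightarrow> game_le G H \<and> game_le H G"

fun game_neg :: "game \<Rightarrow> game" where
  "game_neg (Game L R) = Game (map game_neg R) (map game_neg L)"

function game_plus :: "game \<Rightarrow> game \<Rightarrow> game" where
  "game_plus (Game GL GR) (Game HL HR) =
     Game (map (\<lambda>g. game_plus g (Game HL HR)) GL @ map (\<lambda>h. game_plus (Game GL GR) h) HL)
          (map (\<lambda>g. game_plus g (Game HL HR)) GR @ map (\<lambda>h. game_plus (Game GL GR) h) HR)"
  by pat_completeness auto
termination
  by (relation "measure (\<lambda>(x,y). size x + size y)") (auto dest: size_lopt size_ropt)

definition game_zero :: game where "game_zero = Game [] []"
definition game_star :: game where "game_star = Game [game_zero] [game_zero]"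

fun game_nat :: "nat \<Rightarrow> game" where
  "game_nat 0 = game_zero"
| "game_nat (Suc k) = Game [game_nat k] []"

definition s_game :: "nat \<Rightarrow> game" where
  "s_game m = (if even m then game_zero else game_star)"

fun canonical :: "game \<Rightarrow> bool" where
  "canonical (Game L R) =
    ((\<forall>x\<in>set L. canonical x) \<and> (\<forall>x\<in>set R. canonical x)
     \<and> (\<forall>i<length L. \<forall>j<length L. i \<noteq> j \<longrightarrow> \<not> game_le (L!i) (L!j))
     \<and> (\<forall>i<length R. \<forall>j<length R. i \<noteq> j \<longrightarrow> \<not> game_le (R!j) (R!i))
     \<and> (\<forall>x\<in>set L. \<forall>y\<in>set (ropts x). \<not> game_le y (Game L R))
     \<and> (\<forall>x\<in>set R. \<forall>y\<in>set (lopts x). \<not> game_le (Game L R) y))"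

definition canonical_form_of :: "game \<Rightarrow> game \<Rightarrow> bool" where
  "canonical_form_of G K \<longleftrightarrow> canonical K \<and> game_eq G K"

lemma filter_remove_less:
  assumes "v \<in> set V" "P v"
  shows "length (filter (\<lambda>x. x \<noteq> v \<and> P x) V) < length (filter P V)"
  using assms
proof (induction V)
  case Nil then show ?case by simp
next
  case (Cons a V)
  show ?case
  proof (cases "a = v")
    case True
    have "length (filter (\<lambda>x. x \<noteq> v \<and> P x) V) \<le> length (filter P V)"
      by (induction V) auto
    then show ?thesis using True Cons by simp
  next
    case False
    then show ?thesis using Cons by auto
  qed
qed

text \<open>Snort on a graph with vertex list V and (symmetric) adjacency E, in the position where
  the vertices in B are coloured blue (Left) and those in R red (Right).\<close>
function snort :: "'v list \<Rightarrow> ('v \<Rightarrow> 'v \<Rightarrow> bool) \<Rightarrow> 'v list \<Rightarrow> 'v list \<Rightarrow> game" where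
  "snort V E B R =
     Game (map (\<lambda>v. snort V E (v # B) R)
             (filter (\<lambda>v. v \<notin> set B \<and> v \<notin> set R \<and> (\<forall>u\<in>set R. \<not> E u v)) V))
          (map (\<lambda>v. snort V E B (v # R))
             (filter (\<lambda>v. v \<notin> set B \<and> v \<notin> set R \<and> (\<forall>u\<in>set B. \<not> E u v)) V))"
  by pat_completeness auto
termination
proof (relation "measure (\<lambda>(V,E,B,R). length (filter (\<lambda>v. v \<notin> set B \<and> v \<notin> set R) V))")
  show "wf (measure (\<lambda>(V,E,B,R). length (filter (\<lambda>v. v \<notin> set B \<and> v \<notin> set R) V)))" by simp
next
  fix V :: "'v list" and E B R v
  assume "v \<in> set (filter (\<lambda>v. v \<notin> set B \<and> v \<notin> set R \<and> (\<forall>u\<in>set R. \<not> E u v)) V)"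
  then have v: "v \<in> set V" "v \<notin> set B" "v \<notin> set R" by auto
  show "((V, E, v # B, R), V, E, B, R) \<in> measure (\<lambda>(V,E,B,R). length (filter (\<lambda>v. v \<notin> set B \<and> v \<notin> set R) V))"
    using filter_remove_less[of v V "\<lambda>x. x \<notin> set B \<and> x \<notin> set R"] v by (simp add: conj_commute conj_left_commute)
next
  fix V :: "'v list" and E B R v
  assume "v \<in> set (filter (\<lambda>v. v \<notin> set B \<and> v \<notin> set R \<and> (\<forall>u\<in>set B. \<not> E u v)) V)"
  then have v: "v \<in> set V" "v \<notin> set B" "v \<notin> set R" by auto
  show "((V, E, B, v # R), V, E, B, R) \<in> measure (\<lambda>(V,E,B,R). length (filter (\<lambda>v. v \<notin> set B \<and> v \<notin> set R) V))"
    using filter_remove_less[of v V "\<lambda>x. x \<notin> set B \<and> x \<notin> set R"] v by (simp add: conj_commute conj_left_commute)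
qed

datatype cvert = VA | VB | VC | LA nat | LB nat | LC nat

definition cat_vertices :: "nat \<Rightarrow> cvert list" where
  "cat_vertices n = [VA, VB, VC] @ map LA [1..<n+2] @ map LB [1..<n+1] @ map LC [1..<n+2]"

fun cat_adj0 :: "nat \<Rightarrow> cvert \<Rightarrow> cvert \<Rightarrow> bool" where
  "cat_adj0 n VA VB = True"
| "cat_adj0 n VB VC = True"
| "cat_adj0 n (LA i) VA = (1 \<le> i \<and> i \<le> n + 1)"
| "cat_adj0 n (LC i) VC = (1 \<le> i \<and> i \<le> n + 1)"
| "cat_adj0 n (LB j) VB = (1 \<le> j \<and> j \<le> n)"
| "cat_adj0 n _ _ = False"

definition cat_adj :: "nat \<Rightarrow> cvert \<Rightarrow> cvert \<Rightarrow> bool" where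
  "cat_adj n x y \<longleftrightarrow> cat_adj0 n x y \<or> cat_adj0 n y x"

definition snort_caterpillar :: "nat \<Rightarrow> game" where
  "snort_caterpillar n = snort (cat_vertices n) (cat_adj n) [] []"

end

theory Submission
  imports Defs
begin

text \<open>No switch is ever added to another game: every Snort position is compared directly with an
  integer, an integer plus star, or one of the few switches in the claim. Two facts give most of
  the upper bounds. First, a position is worth at most the number of vertices available to Left.
  Second, after any two Left moves one of the three stars is still untouched; a Right leaf move
  there kills its centre and brings the position down to at most 2n+2+s(n-1). Hence two Left
  moves never get beyond {3n+2 | 2n+2+s(n-1)}, so every Left opening other than b or a leaf of b
  is bounded by the second option as soon as Right has a reply worth at most s(n). The openings
  at b and its leaves are bounded by 2n+1+s(n), again by a reply in an untouched star. The
  openings at b and at a attain the two bounds, and colour reversal gives the other half.\<close>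

section \<open>Order and negation on games\<close>

lemma game_le_iff:
  "game_le x y \<longleftrightarrow> (\<forall>g\<in>set (lopts x). \<not> game_le y g) \<and> (\<forall>h\<in>set (ropts y). \<not> game_le h x)"
  by (cases x; cases y) auto

lemma size_lopts: "g \<in> set (lopts x) \<Longrightarrow> size g < size x"
  by (cases x) (auto dest: size_lopt)

lemma size_ropts: "g \<in> set (ropts x) \<Longrightarrow> size g < size x"
  by (cases x) (auto dest: size_ropt)

lemma game_le_refl [simp]: "game_le x x"
proof (induction "size x" arbitrary: x rule: less_induct)
  case less
  have "\<not> game_le x g" if "g \<in> set (lopts x)" for g
    using less[OF size_lopts[OF that]] that game_le_iff[of x g] by blast
  moreover have "\<not> game_le h x" if "h \<in> set (ropts x)" for h
    using less[OF size_ropts[OF that]] that game_le_iff[of h x] by blast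
  ultimately show ?case using game_le_iff[of x x] by blast
qed

lemma game_le_trans: "game_le x y \<Longrightarrow> game_le y z \<Longrightarrow> game_le x z"
proof (induction "size x + size y + size z" arbitrary: x y z rule: less_induct)
  case less
  have "\<not> game_le z g" if g: "g \<in> set (lopts x)" for g
  proof
    assume "game_le z g"
    then have "game_le y g" using less(1)[of y z g] less(3) size_lopts[OF g] by simp
    then show False using g less(2) game_le_iff[of x y] by blast
  qed
  moreover have "\<not> game_le h x" if h: "h \<in> set (ropts z)" for h
  proof
    assume "game_le h x"
    then have "game_le h y" using less(1)[of h x y] less(2) size_ropts[OF h] by simp
    then show False using h less(3) game_le_iff[of y z] by blast
  qed
  ultimately show ?case using game_le_iff[of x z] by blast
qed

text \<open>Left opens in \<open>x\<close> with \<open>g\<close> and has not fallen below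
  \<open>y\<close>. With its mirror image this is how most inequalities below are refuted: by naming
  one good move.\<close>

lemma not_game_le_lopt: "g \<in> set (lopts x) \<Longrightarrow> game_le y g \<Longrightarrow> \<not> game_le x y"
  using game_le_iff by blast

lemma not_game_le_ropt: "h \<in> set (ropts y) \<Longrightarrow> game_le h x \<Longrightarrow> \<not> game_le x y"
  using game_le_iff by blast

lemma lopts_neg [simp]: "lopts (game_neg x) = map game_neg (ropts x)"
  and ropts_neg [simp]: "ropts (game_neg x) = map game_neg (lopts x)"
  by (cases x; simp)+

lemma game_neg_neg [simp]: "game_neg (game_neg x) = x"
  by (induction x) (auto intro!: map_idI)

lemma game_le_neg [simp]: "game_le (game_neg x) (game_neg y) \<longleftrightarrow> game_le y x"
proof (induction "size x + size y" arbitrary: x y rule: less_induct)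
  case less
  have "game_le (game_neg y) (game_neg g) \<longleftrightarrow> game_le g y" if "g \<in> set (ropts x)" for g
    using less[of y g] size_ropts[OF that] by simp
  moreover have "game_le (game_neg h) (game_neg x) \<longleftrightarrow> game_le x h" if "h \<in> set (lopts y)" for h
    using less[of h x] size_lopts[OF that] by simp
  ultimately show ?case
    using game_le_iff[of "game_neg x" "game_neg y"] game_le_iff[of y x] by auto
qed

text \<open>Phrased through \<open>lopts\<close> and \<open>ropts\<close> so that it applies to
  games such as \<open>num k e\<close> that are not written with the constructor.\<close>

lemma canonical_iff:
  "canonical x \<longleftrightarrow>
    (\<forall>y\<in>set (lopts x) \<union> set (ropts x). canonical y)
     \<and> (\<forall>i<length (lopts x). \<forall>j<length (lopts x). i \<noteq> j \<longrightarrow> \<not> game_le (lopts x ! i) (lopts x ! j))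
     \<and> (\<forall>i<length (ropts x). \<forall>j<length (ropts x). i \<noteq> j \<longrightarrow> \<not> game_le (ropts x ! j) (ropts x ! i))
     \<and> (\<forall>y\<in>set (lopts x). \<forall>z\<in>set (ropts y). \<not> game_le z x)
     \<and> (\<forall>y\<in>set (ropts x). \<forall>z\<in>set (lopts y). \<not> game_le x z)"
  by (cases x) (simp only: canonical.simps lopts.simps ropts.simps ball_Un conj_assoc)

lemma canonical_neg: "canonical x \<Longrightarrow> canonical (game_neg x)"
proof (induction "size x" arbitrary: x rule: less_induct)
  case less
  note c = less.prems[unfolded canonical_iff[of x]]
  have "canonical (game_neg y)" if "y \<in> set (lopts x) \<union> set (ropts x)" for y
    using that c less.hyps[of y] size_lopts size_ropts by blast
  then show ?case using c by (subst canonical_iff) auto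
qed

section \<open>Integers, and integers plus star\<close>

definition gint :: "int \<Rightarrow> game" where
  "gint k = (if k \<ge> 0 then game_nat (nat k) else game_neg (game_nat (nat (- k))))"

text \<open>The canonical form of the integer k, plus star if e holds.\<close>
definition num :: "int \<Rightarrow> bool \<Rightarrow> game" where
  "num k e = (if e then Game [gint k] [gint k] else gint k)"

lemma game_nat_opts [simp]:
  "lopts (game_nat m) = (if m = 0 then [] else [game_nat (m - 1)])" "ropts (game_nat m) = []"
  by (cases m; simp add: game_zero_def)+

lemma lopts_num [simp]:
  "lopts (num k e) = (if e then [num k False] else if k > 0 then [num (k - 1) False] else [])"
  by (auto simp: num_def gint_def nat_diff_distrib game_zero_def)

lemma ropts_num [simp]:
  "ropts (num k e) = (if e then [num k False] else if k < 0 then [num (k + 1) False] else [])"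
proof -
  have "nat (- k) - 1 = nat (- (k + 1))" by simp
  \<comment> \<open>At -1 the Right option comes out as the negative of \<open>game_nat 0\<close>,
    while \<open>num 0 False\<close> unfolds to \<open>game_nat 0\<close> itself; both are
    zero.\<close>
  moreover have "nat (- (k + 1)) = 0" if "k = - 1" using that by simp
  ultimately show ?thesis by (auto simp: num_def gint_def game_zero_def)
qed

text \<open>A move strips the star or brings the integer one closer to zero, so the comparison
  reduces to pairs of smaller weight. The star bits have to agree at equal integers because k and k
  + * are confused.\<close>

lemma num_le [simp]: "game_le (num k e) (num k' e') \<longleftrightarrow> k < k' \<or> k = k' \<and> e = e'"
proof (induction "2 * nat \<bar>k\<bar> + of_bool e + (2 * nat \<bar>k'\<bar> + of_bool e')"
    arbitrary: k e k' e' rule: less_induct)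
  case less
  have l: "game_le (num k' e') (num k False) \<longleftrightarrow> k' < k \<or> k' = k \<and> \<not> e'" if e
    using less[of k' e' k False] that by simp
  have l': "game_le (num k' e') (num (k - 1) False) \<longleftrightarrow> k' < k - 1 \<or> k' = k - 1 \<and> \<not> e'"
    if "\<not> e" "k > 0"
    using less[of k' e' "k - 1" False] that by simp
  have r: "game_le (num k' False) (num k e) \<longleftrightarrow> k' < k \<or> k' = k \<and> \<not> e" if e'
    using less[of k' False k e] that by simp
  have r': "game_le (num (k' + 1) False) (num k e) \<longleftrightarrow> k' + 1 < k \<or> k' + 1 = k \<and> \<not> e"
    if "\<not> e'" "k' < 0"
    using less[of "k' + 1" False k e] that by simp
  have "game_le (num k e) (num k' e') \<longleftrightarrow>
      (if e then \<not> game_le (num k' e') (num k False)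
       else k > 0 \<longrightarrow> \<not> game_le (num k' e') (num (k - 1) False)) \<and>
      (if e' then \<not> game_le (num k' False) (num k e)
       else k' < 0 \<longrightarrow> \<not> game_le (num (k' + 1) False) (num k e))"
    by (subst game_le_iff) simp
  then show ?case using l l' r r' by (smt (verit))
qed

lemma game_neg_num: "game_neg (num k e) = num (- k) e"
  by (auto simp: num_def gint_def game_zero_def)

lemma game_plus_nat_zero: "game_plus (game_nat k) game_zero = game_nat k"
  by (induction k) (auto simp: game_zero_def)

lemma num_of_nat: "num (int m) False = game_nat m"
  by (simp add: num_def gint_def)

text \<open>Links \<open>num\<close> to the sums in the claim. In (k + 1) + * the Left option k + *
  is dominated by k + 1, and what remains is {k + 1 | k + 1}.\<close>

lemma game_eq_plus_star: "game_eq (num (int k) True) (game_plus (game_nat k) game_star)"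
proof (induction k)
  case 0
  show ?case by (simp add: game_star_def game_zero_def num_def gint_def game_eq_def)
next
  case (Suc k)
  define S where "S = game_plus (game_nat (Suc k)) game_star"
  have lopts: "lopts S = [game_plus (game_nat k) game_star, num (int (Suc k)) False]"
    and ropts: "ropts S = [num (int (Suc k)) False]"
    unfolding num_of_nat using game_plus_nat_zero[of "Suc k"]
    by (simp_all add: S_def game_star_def)
  have "\<not> game_le (num (int (Suc k)) True) (game_plus (game_nat k) game_star)"
  proof
    assume "game_le (num (int (Suc k)) True) (game_plus (game_nat k) game_star)"
    then have "game_le (num (int (Suc k)) True) (num (int k) True)"
      using game_le_trans[OF _ conjunct2[OF Suc[unfolded game_eq_def]]] by blast
    then show False by simp
  qed
  moreover have "\<not> game_le S (num (int (Suc k)) False)"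
    by (rule not_game_le_lopt[of "num (int (Suc k)) False"]) (simp_all add: lopts del: of_nat_Suc)
  moreover have "\<not> game_le (num (int (Suc k)) False) S"
    by (rule not_game_le_ropt[of "num (int (Suc k)) False"]) (simp_all add: ropts del: of_nat_Suc)
  moreover have "game_le (num (int (Suc k)) True) S \<longleftrightarrow>
      \<not> game_le S (num (int (Suc k)) False) \<and> \<not> game_le (num (int (Suc k)) False) (num (int (Suc k)) True)"
    by (subst game_le_iff) (simp add: ropts)
  moreover have "game_le S (num (int (Suc k)) True) \<longleftrightarrow>
      \<not> game_le (num (int (Suc k)) True) (game_plus (game_nat k) game_star) \<and>
      \<not> game_le (num (int (Suc k)) True) (num (int (Suc k)) False) \<and>
      \<not> game_le (num (int (Suc k)) False) S"
    by (subst game_le_iff) (simp add: lopts)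
  ultimately have "game_eq (num (int (Suc k)) True) S"
    by (simp add: game_eq_def)
  then show ?case by (simp only: S_def)
qed

lemma game_eq_plus_s_game: "game_eq (num (int k) (odd m)) (game_plus (game_nat k) (s_game m))"
  using game_eq_plus_star[of k]
  by (cases "even m") (auto simp: s_game_def game_plus_nat_zero num_of_nat game_eq_def)

section \<open>Snort positions as pairs of available vertex sets\<close>

text \<open>A Snort position is determined by the vertices P and Q still available to Left and to
  Right. Unlike the colourings, such pairs can be compared by inclusion.\<close>
function tinted :: "('v \<Rightarrow> 'v \<Rightarrow> bool) \<Rightarrow> 'v list \<Rightarrow> 'v list \<Rightarrow> game" where
  "tinted E P Q =
     Game (map (\<lambda>v. tinted E (filter (\<lambda>u. u \<noteq> v) P) (filter (\<lambda>u. u \<noteq> v \<and> \<not> E v u) Q)) P)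
          (map (\<lambda>v. tinted E (filter (\<lambda>u. u \<noteq> v \<and> \<not> E v u) P) (filter (\<lambda>u. u \<noteq> v) Q)) Q)"
  by pat_completeness auto
termination
proof (relation "measure (\<lambda>(E, P, Q). length P + length Q)")
  show "wf (measure (\<lambda>(E :: 'v \<Rightarrow> 'v \<Rightarrow> bool, P :: 'v list, Q :: 'v list). length P + length Q))" by simp
next
  fix E :: "'v \<Rightarrow> 'v \<Rightarrow> bool" and P Q :: "'v list" and v
  show "((E, filter (\<lambda>u. u \<noteq> v) P, filter (\<lambda>u. u \<noteq> v \<and> \<not> E v u) Q), E, P, Q)
      \<in> measure (\<lambda>(E, P, Q). length P + length Q)" if "v \<in> set P"
    using that by (auto intro!: add_less_le_mono length_filter_less)
  show "((E, filter (\<lambda>u. u \<noteq> v \<and> \<not> E v u) P, filter (\<lambda>u. u \<noteq> v) Q), E, P, Q)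
      \<in> measure (\<lambda>(E, P, Q). length P + length Q)" if "v \<in> set Q"
    using that by (auto intro!: add_le_less_mono length_filter_less)
qed

declare tinted.simps [simp del] snort.simps [simp del]

text \<open>Colouring a vertex takes it from both players and its neighbours from the opponent, so
  both recursions filter the same lists.\<close>

lemma snort_eq_tinted:
  "snort V E B R = tinted E
     (filter (\<lambda>v. v \<notin> set B \<and> v \<notin> set R \<and> (\<forall>u\<in>set R. \<not> E u v)) V)
     (filter (\<lambda>v. v \<notin> set B \<and> v \<notin> set R \<and> (\<forall>u\<in>set B. \<not> E u v)) V)"
proof (induction V E B R rule: snort.induct)
  case (1 V E B R)
  show ?case
    unfolding snort.simps[of V E B R]
    apply (subst tinted.simps)
    using 1 by (auto intro!: arg_cong2[where f = "tinted E"] filter_cong)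
qed

text \<open>Left can copy each move made in \<open>P\<close>, Right each move made in
  \<open>Q'\<close>, and equal moves preserve the inclusions. As only sets are compared, order and
  repetition in the lists do not affect the value.\<close>

lemma tinted_mono:
  assumes "set P \<subseteq> set P'" "set Q' \<subseteq> set Q"
  shows "game_le (tinted E P Q) (tinted E P' Q')"
  using assms
proof (induction "length P + length Q'" arbitrary: P Q P' Q' rule: less_induct)
  case less
  have "\<not> game_le (tinted E P' Q') g" if "g \<in> set (lopts (tinted E P Q))" for g
  proof -
    obtain v where v: "v \<in> set P"
      and g: "g = tinted E (filter (\<lambda>u. u \<noteq> v) P) (filter (\<lambda>u. u \<noteq> v \<and> \<not> E v u) Q)"
      using \<open>g \<in> _\<close> by (subst (asm) tinted.simps) auto
    have "game_le g (tinted E (filter (\<lambda>u. u \<noteq> v) P') (filter (\<lambda>u. u \<noteq> v \<and> \<not> E v u) Q'))"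
      unfolding g using less.prems v
      by (intro less.hyps) (auto intro!: add_less_le_mono length_filter_less)
    then show ?thesis
      using v less.prems by (intro not_game_le_lopt) (subst tinted.simps, auto)
  qed
  moreover have "\<not> game_le g (tinted E P Q)" if "g \<in> set (ropts (tinted E P' Q'))" for g
  proof -
    obtain v where v: "v \<in> set Q'"
      and g: "g = tinted E (filter (\<lambda>u. u \<noteq> v \<and> \<not> E v u) P') (filter (\<lambda>u. u \<noteq> v) Q')"
      using \<open>g \<in> _\<close> by (subst (asm) tinted.simps) auto
    have "game_le (tinted E (filter (\<lambda>u. u \<noteq> v \<and> \<not> E v u) P) (filter (\<lambda>u. u \<noteq> v) Q)) g"
      unfolding g using less.prems v
      by (intro less.hyps) (auto intro!: add_le_less_mono length_filter_less)
    then show ?thesis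
      using v less.prems by (intro not_game_le_ropt) (subst tinted.simps, auto)
  qed
  ultimately show ?case using game_le_iff by blast
qed

lemma tinted_neg: "game_neg (tinted E P Q) = tinted E Q P"
proof (induction E P Q rule: tinted.induct)
  case (1 E P Q)
  show ?case
    unfolding tinted.simps[of E P Q] tinted.simps[of E Q P] using 1 by simp
qed

text \<open>By \<open>tinted_mono\<close> any listing of the two sets gives an equal game, so the
  choice of lists is immaterial up to equality.\<close>

definition pos :: "('v \<Rightarrow> 'v \<Rightarrow> bool) \<Rightarrow> 'v set \<Rightarrow> 'v set \<Rightarrow> game" where
  "pos E P Q = tinted E (SOME xs. set xs = P) (SOME ys. set ys = Q)"

abbreviation nb :: "('v \<Rightarrow> 'v \<Rightarrow> bool) \<Rightarrow> 'v \<Rightarrow> 'v set" where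
  "nb E v \<equiv> {u. E v u}"

lemma set_some_list: "finite A \<Longrightarrow> set (SOME xs. set xs = A) = A"
  by (rule someI_ex) (rule finite_list)

lemma pos_mono:
  "finite P' \<Longrightarrow> finite Q \<Longrightarrow> P \<subseteq> P' \<Longrightarrow> Q' \<subseteq> Q \<Longrightarrow> game_le (pos E P Q) (pos E P' Q')"
  unfolding pos_def by (rule tinted_mono) (simp_all add: set_some_list finite_subset)

lemma tinted_le_pos: "game_le (tinted E P Q) (pos E (set P) (set Q))"
  unfolding pos_def by (rule tinted_mono) (simp_all add: set_some_list)

lemma pos_neg: "game_neg (pos E P Q) = pos E Q P"
  by (simp add: pos_def tinted_neg)

text \<open>The Right option after \<open>v\<close> is a \<open>tinted\<close> game on filtered
  lists, not a \<open>pos\<close>; \<open>tinted_le_pos\<close> closes this gap, so that play can be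
  argued on sets.\<close>

lemma not_le_pos:
  assumes "finite P" "finite Q" "v \<in> Q" "game_le (pos E (P - {v} - nb E v) (Q - {v})) g"
  shows "\<not> game_le g (pos E P Q)"
proof -
  define xs ys where "xs = (SOME xs. set xs = P)" and "ys = (SOME xs. set xs = Q)"
  have s: "set xs = P" "set ys = Q" using assms by (simp_all add: xs_def ys_def set_some_list)
  let ?h = "tinted E (filter (\<lambda>u. u \<noteq> v \<and> \<not> E v u) xs) (filter (\<lambda>u. u \<noteq> v) ys)"
  have "set (filter (\<lambda>u. u \<noteq> v \<and> \<not> E v u) xs) = P - {v} - nb E v"
    "set (filter (\<lambda>u. u \<noteq> v) ys) = Q - {v}" using s by auto
  then have "game_le ?h g"
    using assms(4) tinted_le_pos game_le_trans by metis
  moreover have "?h \<in> set (ropts (tinted E xs ys))"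
    using assms s by (subst tinted.simps) auto
  ultimately show ?thesis
    unfolding pos_def xs_def[symmetric] ys_def[symmetric] by (rule not_game_le_ropt[rotated])
qed

lemma not_pos_le:
  assumes "finite P" "finite Q" "v \<in> P" "game_le g (pos E (P - {v}) (Q - {v} - nb E v))"
  shows "\<not> game_le (pos E P Q) g"
  using not_le_pos[OF assms(2,1,3), of E "game_neg g"] assms(4) game_le_neg
  by (metis pos_neg)

lemma pos_leI:
  assumes "finite P" "finite Q"
    and "\<And>v. v \<in> P \<Longrightarrow> \<not> game_le g (pos E (P - {v}) (Q - {v} - nb E v))"
    and "\<And>h. h \<in> set (ropts g) \<Longrightarrow> \<not> game_le h (pos E P Q)"
  shows "game_le (pos E P Q) g"
proof -
  define xs ys where "xs = (SOME xs. set xs = P)" and "ys = (SOME xs. set xs = Q)"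
  have s: "set xs = P" "set ys = Q" using assms by (simp_all add: xs_def ys_def set_some_list)
  have "\<not> game_le g l" if "l \<in> set (lopts (tinted E xs ys))" for l
  proof
    assume g: "game_le g l"
    obtain v where v: "v \<in> P"
      and l: "l = tinted E (filter (\<lambda>u. u \<noteq> v) xs) (filter (\<lambda>u. u \<noteq> v \<and> \<not> E v u) ys)"
      using \<open>l \<in> _\<close> s by (subst (asm) tinted.simps) auto
    have "set (filter (\<lambda>u. u \<noteq> v \<and> \<not> E v u) ys) = Q - {v} - nb E v"
      "set (filter (\<lambda>u. u \<noteq> v) xs) = P - {v}" using s by auto
    then have "game_le g (pos E (P - {v}) (Q - {v} - nb E v))"
      using g l tinted_le_pos game_le_trans by metis
    with assms(3) v show False by blast
  qed
  then show ?thesis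
    using assms(4) unfolding pos_def xs_def[symmetric] ys_def[symmetric]
    by (subst game_le_iff) blast
qed

lemma le_posI:
  assumes "finite P" "finite Q"
    and "\<And>v. v \<in> Q \<Longrightarrow> \<not> game_le (pos E (P - {v} - nb E v) (Q - {v})) g"
    and "\<And>h. h \<in> set (lopts g) \<Longrightarrow> \<not> game_le (pos E P Q) h"
  shows "game_le g (pos E P Q)"
proof -
  have "game_le (pos E Q P) (game_neg g)"
  proof (rule pos_leI)
    show "\<not> game_le (game_neg g) (pos E (Q - {v}) (P - {v} - nb E v))" if "v \<in> Q" for v
      using assms(3)[OF that] game_le_neg by (metis pos_neg)
    show "\<not> game_le h (pos E Q P)" if "h \<in> set (ropts (game_neg g))" for h
      using assms(4) that game_le_neg by (auto simp flip: pos_neg[of E P Q])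
  qed (use assms in auto)
  then show ?thesis by (metis game_le_neg pos_neg)
qed

section \<open>Values and bounds when the players cannot interfere\<close>

text \<open>Without edges between P and Q no move affects any other vertex.\<close>
lemma cold_le:
  assumes "finite P" "finite Q" "\<And>u v. u \<in> P \<Longrightarrow> v \<in> Q \<Longrightarrow> \<not> E u v \<and> \<not> E v u"
  shows "game_le (pos E P Q) (num (int (card (P - Q)) - int (card (Q - P))) (odd (card (P \<inter> Q))))"
    and "game_le (num (int (card (P - Q)) - int (card (Q - P))) (odd (card (P \<inter> Q)))) (pos E P Q)"
proof -
  \<comment> \<open>A private vertex is a spare move for its owner; a common vertex is a star, and
    stars cancel in pairs.\<close>
  define val where "val P Q = num (int (card (P - Q)) - int (card (Q - P))) (odd (card (P \<inter> Q)))"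
    for P Q :: "'a set"
  have val_neg: "game_neg (val P Q) = val Q P" for P Q
    by (simp add: val_def game_neg_num Int_commute)
  have val_own: "val (P - {v}) Q
      = num (int (card (P - Q)) - int (card (Q - P)) - 1) (odd (card (P \<inter> Q)))"
    if "finite P" "v \<in> P" "v \<notin> Q" for v and P Q :: "'a set"
  proof -
    have "P - {v} - Q = (P - Q) - {v}" "Q - (P - {v}) = Q - P" "(P - {v}) \<inter> Q = P \<inter> Q"
      using that by auto
    moreover have "card (P - Q) > 0" using that by (auto simp: card_gt_0_iff)
    ultimately show ?thesis using that by (simp add: val_def of_nat_diff algebra_simps)
  qed
  have val_free: "val (P - {v}) (Q - {v})
      = num (int (card (P - Q)) - int (card (Q - P))) (even (card (P \<inter> Q)))"
    if "finite P" "v \<in> P" "v \<in> Q" for v and P Q :: "'a set"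
  proof -
    have "P - {v} - (Q - {v}) = P - Q" "Q - {v} - (P - {v}) = Q - P"
      "(P - {v}) \<inter> (Q - {v}) = P \<inter> Q - {v}"
      using that by auto
    moreover have "card (P \<inter> Q) > 0" "P \<inter> Q \<noteq> {}" using that by (auto simp: card_gt_0_iff)
    ultimately show ?thesis using that by (simp add: val_def)
  qed
  have "game_le (pos E P Q) (val P Q) \<and> game_le (val P Q) (pos E P Q)"
    using assms
  proof (induction "card P + card Q" arbitrary: P Q rule: less_induct)
    case less
    have left: "game_le (pos E (P - {v}) (Q - {v} - nb E v)) (val (P - {v}) (Q - {v})) \<and>
      game_le (val (P - {v}) (Q - {v})) (pos E (P - {v}) (Q - {v} - nb E v))" if "v \<in> P" for v
    proof -
      have "Q - {v} - nb E v = Q - {v}" using less.prems that by auto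
      moreover have "card (P - {v}) + card (Q - {v}) < card P + card Q"
        using that less.prems by (intro add_less_le_mono card_Diff1_less card_mono) auto
      ultimately show ?thesis using less.hyps[of "P - {v}" "Q - {v}"] less.prems by simp
    qed
    have right: "game_le (pos E (P - {v} - nb E v) (Q - {v})) (val (P - {v}) (Q - {v})) \<and>
      game_le (val (P - {v}) (Q - {v})) (pos E (P - {v} - nb E v) (Q - {v}))" if "v \<in> Q" for v
    proof -
      have "P - {v} - nb E v = P - {v}" using less.prems that by auto
      moreover have "card (P - {v}) + card (Q - {v}) < card P + card Q"
        using that less.prems by (intro add_le_less_mono card_Diff1_less card_mono) auto
      ultimately show ?thesis using less.hyps[of "P - {v}" "Q - {v}"] less.prems by simp
    qed
    have own: "val (P - {v}) (Q - {v})
        = num (int (card (P - Q)) - int (card (Q - P)) - 1) (odd (card (P \<inter> Q)))"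
      if "v \<in> P" "v \<notin> Q" for v
      using val_own[of P v Q] that less.prems by simp
    have own': "val (P - {v}) (Q - {v})
        = num (int (card (P - Q)) - int (card (Q - P)) + 1) (odd (card (P \<inter> Q)))"
      if "v \<in> Q" "v \<notin> P" for v
    proof -
      have "val P (Q - {v}) = game_neg (val (Q - {v}) P)" by (simp add: val_neg)
      then show ?thesis
        using val_own[of Q v P] that less.prems by (simp add: game_neg_num Int_commute algebra_simps)
    qed
    have free: "val (P - {v}) (Q - {v})
        = num (int (card (P - Q)) - int (card (Q - P))) (even (card (P \<inter> Q)))"
      if "v \<in> Q" "v \<in> P" for v
      using val_free[of P v Q] that less.prems by simp
    have "game_le (pos E P Q) (val P Q)"
    proof (rule pos_leI)
      \<comment> \<open>A private move costs Left one and a common move toggles the star; neither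
        result is at least the old value.\<close>
      show "\<not> game_le (val P Q) (pos E (P - {v}) (Q - {v} - nb E v))" if "v \<in> P" for v
      proof
        assume "game_le (val P Q) (pos E (P - {v}) (Q - {v} - nb E v))"
        then have "game_le (val P Q) (val (P - {v}) (Q - {v}))"
          using game_le_trans[OF _ conjunct1[OF left[OF that]]] by blast
        then show False
          using own[OF that] free[of v] that by (cases "v \<in> Q") (auto simp: val_def[of P Q])
      qed
      \<comment> \<open>Right's move in the value is realised in the position: a common vertex
        removes the star; without a star, a negative value guarantees a private vertex of
        Right.\<close>
      show "\<not> game_le h (pos E P Q)" if h: "h \<in> set (ropts (val P Q))" for h
      proof (cases "odd (card (P \<inter> Q))")
        case True
        then have "P \<inter> Q \<noteq> {}" by (intro notI) simp
        then obtain v where v: "v \<in> P" "v \<in> Q" by blast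
        then have "h = val (P - {v}) (Q - {v})"
          using h True free[of v] by (simp add: val_def)
        then show ?thesis using right[of v] v less.prems by (intro not_le_pos[of _ _ v]) auto
      next
        case False
        then have lt: "card (P - Q) < card (Q - P)"
          using h by (simp add: val_def split: if_splits)
        then have "Q - P \<noteq> {}" by (intro notI) simp
        then obtain v where v: "v \<notin> P" "v \<in> Q" by auto
        then have "h = val (P - {v}) (Q - {v})"
          using h False own'[of v] lt by (simp add: val_def)
        then show ?thesis using right[of v] v less.prems by (intro not_le_pos[of _ _ v]) auto
      qed
    qed (use less.prems in auto)
    moreover have "game_le (val P Q) (pos E P Q)"
    proof (rule le_posI)
      show "\<not> game_le (pos E (P - {v} - nb E v) (Q - {v})) (val P Q)" if "v \<in> Q" for v
      proof
        assume "game_le (pos E (P - {v} - nb E v) (Q - {v})) (val P Q)"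
        then have "game_le (val (P - {v}) (Q - {v})) (val P Q)"
          using game_le_trans[OF conjunct2[OF right[OF that]]] by blast
        then show False
          using own'[OF that] free[of v] that by (cases "v \<in> P") (auto simp: val_def[of P Q])
      qed
      show "\<not> game_le (pos E P Q) h" if h: "h \<in> set (lopts (val P Q))" for h
      proof (cases "odd (card (P \<inter> Q))")
        case True
        then have "P \<inter> Q \<noteq> {}" by (intro notI) simp
        then obtain v where v: "v \<in> P" "v \<in> Q" by blast
        then have "h = val (P - {v}) (Q - {v})"
          using h True free[of v] by (simp add: val_def)
        then show ?thesis using left[of v] v less.prems by (intro not_pos_le[of _ _ v]) auto
      next
        case False
        then have lt: "card (P - Q) > card (Q - P)"
          using h by (simp add: val_def split: if_splits)
        then have "P - Q \<noteq> {}" by (intro notI) simp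
        then obtain v where v: "v \<in> P" "v \<notin> Q" by auto
        then have "h = val (P - {v}) (Q - {v})"
          using h False own[of v] lt by (simp add: val_def)
        then show ?thesis using left[of v] v less.prems by (intro not_pos_le[of _ _ v]) auto
      qed
    qed (use less.prems in auto)
    ultimately show ?case by blast
  qed
  then show "game_le (pos E P Q)
      (num (int (card (P - Q)) - int (card (Q - P))) (odd (card (P \<inter> Q))))"
    and "game_le (num (int (card (P - Q)) - int (card (Q - P))) (odd (card (P \<inter> Q)))) (pos E P Q)"
    by (simp_all add: val_def)
qed

text \<open>Taking every vertex from Right only helps Left, who then has one move per
  vertex.\<close>

lemma pos_le_card:
  assumes "finite P" "finite Q" "int (card P) \<le> k"
  shows "game_le (pos E P Q) (num k False)"
proof -
  have "game_le (pos E P Q) (pos E P {})" using assms by (intro pos_mono) auto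
  moreover have "game_le (pos E P {}) (num (int (card P)) False)"
    using cold_le(1)[of P "{}" E] assms by simp
  moreover have "game_le (num (int (card P)) False) (num k False)" using assms by auto
  ultimately show ?thesis using game_le_trans by blast
qed

text \<open>Right plays a leaf of a star that Left has not touched: its centre dies, and the other
  leaves become isolated vertices that are free for both players.\<close>
lemma star_reply:
  assumes fin: "finite P" "finite Q" and L: "L \<subseteq> P" "L \<subseteq> Q" "L \<noteq> {}" "z \<notin> L"
    and E: "\<And>l u. l \<in> L \<Longrightarrow> u \<in> P \<Longrightarrow> (E l u \<longleftrightarrow> u = z) \<and> (E u l \<longleftrightarrow> u = z)"
    and g: "game_le (num (int (card (P - insert z L))) (even (card L))) g"
  shows "\<not> game_le g (pos E P Q)"
proof -
  from L obtain l where l: "l \<in> L" by blast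
  let ?P = "P - {l} - {z}" and ?F = "L - {l}"
  have "P - {l} - nb E l \<subseteq> ?P" using E[OF l] by auto
  \<comment> \<open>By monotonicity Right may be confined to the other leaves. With \<open>z\<close>
    gone these have no neighbour among Left's vertices, so \<open>cold_le\<close> applies.\<close>
  then have le: "game_le (pos E (P - {l} - nb E l) (Q - {l})) (pos E ?P ?F)"
    using fin L by (intro pos_mono) auto
  have "?F - ?P = {}" using L by auto
  then have 0: "card (?F - ?P) = 0" by (simp only: card.empty)
  have eqs: "?P - ?F = P - insert z L" "?P \<inter> ?F = L - {l}" using L l by auto
  have "finite L" using L fin finite_subset by blast
  moreover from this l have "card L > 0" by (auto simp: card_gt_0_iff)
  \<comment> \<open>One leaf has been spent, so an odd number of common leaves means that
    \<open>card L\<close> is even.\<close>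
  ultimately have "num (int (card (?P - ?F)) - int (card (?F - ?P))) (odd (card (?P \<inter> ?F)))
      = num (int (card (P - insert z L))) (even (card L))"
    unfolding eqs 0 using l L(3) by simp
  moreover have "game_le (pos E ?P ?F)
      (num (int (card (?P - ?F)) - int (card (?F - ?P))) (odd (card (?P \<inter> ?F))))"
    using fin L E by (intro cold_le(1)) (auto intro: finite_subset)
  ultimately have "game_le (pos E (P - {l} - nb E l) (Q - {l})) g"
    using game_le_trans[OF le game_le_trans[OF _ g]] by simp
  then show ?thesis using fin l L by (intro not_le_pos[of _ _ l]) auto
qed

section \<open>The caterpillar and its leaf positions\<close>

definition leafset :: "nat set \<Rightarrow> nat set \<Rightarrow> nat set \<Rightarrow> cvert set" where
  "leafset A B C = LA ` A \<union> LB ` B \<union> LC ` C"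

definition leaves :: "nat \<Rightarrow> cvert \<Rightarrow> cvert set" where
  "leaves n z = (case z of VA \<Rightarrow> LA ` {1..n+1} | VB \<Rightarrow> LB ` {1..n} | VC \<Rightarrow> LC ` {1..n+1} | _ \<Rightarrow> {})"

abbreviation verts :: "nat \<Rightarrow> cvert set" where
  "verts n \<equiv> set (cat_vertices n)"

lemma mem_leafset [simp]:
  "VA \<notin> leafset A B C" "VB \<notin> leafset A B C" "VC \<notin> leafset A B C"
  "LA i \<in> leafset A B C \<longleftrightarrow> i \<in> A" "LB i \<in> leafset A B C \<longleftrightarrow> i \<in> B"
  "LC i \<in> leafset A B C \<longleftrightarrow> i \<in> C"
  by (auto simp: leafset_def)

lemma verts_eq: "verts n = {VA, VB, VC} \<union> leafset {1..n+1} {1..n} {1..n+1}"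
  unfolding cat_vertices_def leafset_def by auto

lemma mem_verts [simp]:
  "VA \<in> verts n" "VB \<in> verts n" "VC \<in> verts n"
  "LA i \<in> verts n \<longleftrightarrow> i \<in> {1..n+1}" "LB i \<in> verts n \<longleftrightarrow> i \<in> {1..n}"
  "LC i \<in> verts n \<longleftrightarrow> i \<in> {1..n+1}"
  unfolding verts_eq by simp_all

lemma cvert_set_eqI:
  assumes "VA \<in> S \<longleftrightarrow> VA \<in> T" "VB \<in> S \<longleftrightarrow> VB \<in> T" "VC \<in> S \<longleftrightarrow> VC \<in> T"
    and "\<And>i. LA i \<in> S \<longleftrightarrow> LA i \<in> T" "\<And>i. LB i \<in> S \<longleftrightarrow> LB i \<in> T" "\<And>i. LC i \<in> S \<longleftrightarrow> LC i \<in> T"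
  shows "S = T"
proof (rule set_eqI)
  show "x \<in> S \<longleftrightarrow> x \<in> T" for x using assms by (cases x) simp_all
qed

lemma finite_leafset [simp]: "finite A \<Longrightarrow> finite B \<Longrightarrow> finite C \<Longrightarrow> finite (leafset A B C)"
  by (simp add: leafset_def)

lemma card_leafset [simp]:
  assumes "finite A" "finite B" "finite C"
  shows "card (leafset A B C) = card A + card B + card C"
proof -
  have "card (leafset A B C) = card (LA ` A \<union> LB ` B) + card (LC ` C)"
    unfolding leafset_def using assms by (intro card_Un_disjoint) auto
  also have "card (LA ` A \<union> LB ` B) = card (LA ` A) + card (LB ` B)"
    using assms by (intro card_Un_disjoint) auto
  finally show ?thesis by (simp add: card_image inj_on_def)
qed

lemma card_verts: "card (verts n) = 3 * n + 5"
  unfolding verts_eq by simp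

text \<open>Leaves are pairwise non-adjacent, so \<open>cold_le\<close> evaluates any position whose
  centres are all gone. The sets enter by membership and the value by equations, so the set
  differences left by a line of play can be used unsimplified.\<close>

lemma leafset_cold:
  assumes "finite A" "finite B" "finite C" "finite A'" "finite B'" "finite C'"
    and P: "VA \<notin> P" "VB \<notin> P" "VC \<notin> P"
      "\<And>i. LA i \<in> P \<longleftrightarrow> i \<in> A" "\<And>i. LB i \<in> P \<longleftrightarrow> i \<in> B" "\<And>i. LC i \<in> P \<longleftrightarrow> i \<in> C"
    and Q: "VA \<notin> Q" "VB \<notin> Q" "VC \<notin> Q"
      "\<And>i. LA i \<in> Q \<longleftrightarrow> i \<in> A'" "\<And>i. LB i \<in> Q \<longleftrightarrow> i \<in> B'" "\<And>i. LC i \<in> Q \<longleftrightarrow> i \<in> C'"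
    and k: "int (card (A - A') + card (B - B') + card (C - C'))
      - int (card (A' - A) + card (B' - B) + card (C' - C)) = k"
    and e: "odd (card (A \<inter> A') + card (B \<inter> B') + card (C \<inter> C')) \<longleftrightarrow> e"
  shows "game_le (pos (cat_adj n) P Q) (num k e)" "game_le (num k e) (pos (cat_adj n) P Q)"
proof -
  have PQ: "P = leafset A B C" "Q = leafset A' B' C'"
    using P Q by (intro cvert_set_eqI; simp)+
  have "leafset A B C - leafset A' B' C' = leafset (A - A') (B - B') (C - C')"
    "leafset A' B' C' - leafset A B C = leafset (A' - A) (B' - B) (C' - C)"
    "leafset A B C \<inter> leafset A' B' C' = leafset (A \<inter> A') (B \<inter> B') (C \<inter> C')"
    by (auto simp: leafset_def)
  moreover have "\<not> cat_adj n u v \<and> \<not> cat_adj n v u"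
    if "u \<in> leafset A B C" "v \<in> leafset A' B' C'" for u v
    using that by (auto simp: leafset_def cat_adj_def)
  ultimately show "game_le (pos (cat_adj n) P Q) (num k e)" "game_le (num k e) (pos (cat_adj n) P Q)"
    using assms(1-6) k e cold_le[of "leafset A B C" "leafset A' B' C'" "cat_adj n"]
    unfolding PQ by simp_all
qed

section \<open>Upper bounds on Left's openings\<close>

abbreviation after1 :: "nat \<Rightarrow> cvert \<Rightarrow> game" where
  "after1 n u \<equiv> pos (cat_adj n) (verts n - {u}) (verts n - {u} - nb (cat_adj n) u)"

text \<open>Bounding an opening with \<open>pos_leI\<close> asks about Left's next move, hence two
  blue moves in a row. The nesting of differences is the one that rule produces.\<close>

abbreviation after2 :: "nat \<Rightarrow> cvert \<Rightarrow> cvert \<Rightarrow> game" where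
  "after2 n u v \<equiv> pos (cat_adj n) (verts n - {u} - {v})
     (verts n - {u} - nb (cat_adj n) u - {v} - nb (cat_adj n) v)"

text \<open>The value once Left holds a and c: Left's next move b makes all 3n+2 leaves private,
  while a leaf of b played by Right kills b and leaves 2n+2 private and n-1 common leaves. For n at
  least 1, \<open>even n\<close> says that n-1 is odd.\<close>

definition threat :: "nat \<Rightarrow> game" where
  "threat n = Game [num (3 * int n + 2) False] [num (2 * int n + 2) (even n)]"

definition A1 :: "nat \<Rightarrow> game" where
  "A1 n = num (2 * int n + 1) (odd n)"

definition A2 :: "nat \<Rightarrow> game" where
  "A2 n = Game [threat n] [num 0 (odd n)]"

lemma opts_threat [simp]:
  "lopts (threat n) = [num (3 * int n + 2) False]" "ropts (threat n) = [num (2 * int n + 2) (even n)]"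
  by (simp_all add: threat_def)

lemma opts_A2 [simp]: "lopts (A2 n) = [threat n]" "ropts (A2 n) = [num 0 (odd n)]"
  by (simp_all add: A2_def)

text \<open>Of 3n+5 vertices, two are blue and the untouched star is lost to Left as private
  material. The result is 2n+2+s(n-1) for the star at b and 2n+1+s(n) for the stars at a and
  c.\<close>

lemma after2_star_reply:
  assumes n: "n \<ge> 1" and uv: "u \<in> verts n" "v \<in> verts n" "u \<noteq> v"
    and z: "z \<in> {VA, VB, VC}" "{u, v} \<inter> insert z (leaves n z) = {}"
    and g: "game_le (num (3 * int n + 2 - int (card (leaves n z))) (even (card (leaves n z)))) g"
  shows "\<not> game_le g (after2 n u v)"
proof (rule star_reply[where z = z and L = "leaves n z"])
  have sub: "insert z (leaves n z) \<subseteq> verts n - {u} - {v}" and z': "z \<notin> leaves n z"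
    and ne: "leaves n z \<noteq> {}" and fin: "finite (leaves n z)"
    using z n unfolding leaves_def by auto
  have adj: "cat_adj n l w = (w = z) \<and> cat_adj n w l = (w = z)" if "l \<in> leaves n z" for l w
    using that z by (cases w) (auto simp: leaves_def cat_adj_def)
  show "leaves n z \<subseteq> verts n - {u} - {v}" "z \<notin> leaves n z" "leaves n z \<noteq> {}"
    using sub z' ne by auto
  show "leaves n z \<subseteq> verts n - {u} - nb (cat_adj n) u - {v} - nb (cat_adj n) v"
    using sub z adj by auto
  have "card (verts n - {u} - {v} - insert z (leaves n z)) = 3 * n + 5 - 2 - Suc (card (leaves n z))"
    using card_Diff_subset[OF _ sub] fin z' uv by (simp add: card_verts)
  \<comment> \<open>Ensures that the preceding subtraction on naturals is not truncated.\<close>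
  moreover have "card (leaves n z) \<le> n + 1"
    using z by (auto simp: leaves_def card_image inj_on_def)
  ultimately have "int (card (verts n - {u} - {v} - insert z (leaves n z)))
      = 3 * int n + 2 - int (card (leaves n z))"
    by simp
  with g show "game_le (num (int (card (verts n - {u} - {v} - insert z (leaves n z))))
      (even (card (leaves n z)))) g"
    by simp
  show "(cat_adj n l w \<longleftrightarrow> w = z) \<and> (cat_adj n w l \<longleftrightarrow> w = z)" if "l \<in> leaves n z" for l w
    using adj[OF that] .
qed auto

lemma after2_le_threat:
  assumes n: "n \<ge> 1" and uv: "u \<in> verts n" "v \<in> verts n" "u \<noteq> v"
  shows "game_le (after2 n u v) (threat n)"
proof (rule pos_leI)
  fix w assume w: "w \<in> verts n - {u} - {v}"
  let ?p = "pos (cat_adj n) (verts n - {u} - {v} - {w})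
    (verts n - {u} - nb (cat_adj n) u - {v} - nb (cat_adj n) v - {w} - nb (cat_adj n) w)"
  \<comment> \<open>A third Left move leaves at most 3n+5-3 vertices.\<close>
  have "game_le ?p (num (3 * int n + 2) False)"
    using w uv by (intro pos_le_card) (simp_all add: card_verts)
  moreover have "\<not> game_le (threat n) (num (3 * int n + 2) False)"
    by (rule not_game_le_lopt[of "num (3 * int n + 2) False"]) (simp_all add: threat_def)
  ultimately show "\<not> game_le (threat n) ?p" using game_le_trans by blast
next
  fix h assume "h \<in> set (ropts (threat n))"
  then have h: "h = num (2 * int n + 2) (even n)" by (simp add: threat_def)
  \<comment> \<open>Two vertices meet at most two of the three stars.\<close>
  have "\<exists>z\<in>{VA, VB, VC}. {u, v} \<inter> insert z (leaves n z) = {}"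
    by (cases u; cases v) (auto simp: leaves_def)
  then obtain z where z: "z \<in> {VA, VB, VC}" "{u, v} \<inter> insert z (leaves n z) = {}" by blast
  moreover from z have "card (leaves n z) = (if z = VB then n else n + 1)"
    using z by (auto simp: leaves_def card_image inj_on_def)
  ultimately show "\<not> game_le h (after2 n u v)"
    using n uv by (intro after2_star_reply[of n u v z]) (auto simp: h)
qed auto

lemma after1_le_A2:
  assumes "n \<ge> 1" "u \<in> verts n" "\<not> game_le (num 0 (odd n)) (after1 n u)"
  shows "game_le (after1 n u) (A2 n)"
proof (rule pos_leI)
  fix v assume "v \<in> verts n - {u}"
  then have "game_le (after2 n u v) (threat n)" using assms by (intro after2_le_threat) auto
  moreover have "\<not> game_le (A2 n) (threat n)"
    by (rule not_game_le_lopt[of "threat n"]) (simp_all add: A2_def)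
  ultimately show "\<not> game_le (A2 n) (after2 n u v)" using game_le_trans by blast
qed (use assms in \<open>auto simp: A2_def\<close>)

text \<open>Right answers at c. Then b is dead for both, the leaves of a and of c balance, and the n
  leaves of b are common: the value is s(n).\<close>

lemma after_VA_le_A2: "n \<ge> 1 \<Longrightarrow> game_le (after1 n VA) (A2 n)"
  by (intro after1_le_A2 not_le_pos[of _ _ VC]
      leafset_cold(1)[of "{1..n+1}" "{1..n}" "{}" "{}" "{1..n}" "{1..n+1}"])
    (auto simp: cat_adj_def)

lemma after_VC_le_A2: "n \<ge> 1 \<Longrightarrow> game_le (after1 n VC) (A2 n)"
  by (intro after1_le_A2 not_le_pos[of _ _ VA]
      leafset_cold(1)[of "{}" "{1..n}" "{1..n+1}" "{1..n+1}" "{1..n}" "{}"])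
    (auto simp: cat_adj_def)

text \<open>Right answers at b, which kills the other two centres for Left. The n leaves of b belong
  to Right and 2n+1 leaves are common, giving at most -n plus star.\<close>

lemma after_LA_le_A2:
  assumes n: "n \<ge> 1" and i: "i \<in> {1..n+1}"
  shows "game_le (after1 n (LA i)) (A2 n)"
proof (intro after1_le_A2 not_le_pos[of _ _ VB])
  let ?P = "leafset ({1..n+1} - {i}) {} {1..n+1}" and ?Q = "leafset ({1..n+1} - {i}) {1..n} {1..n+1}"
  have "verts n - {LA i} - {VB} - nb (cat_adj n) VB = ?P"
    by (rule cvert_set_eqI) (auto simp: cat_adj_def)
  \<comment> \<open>Right's access to c is given up, which can only raise the value.\<close>
  moreover have "?Q \<subseteq> verts n - {LA i} - nb (cat_adj n) (LA i) - {VB}"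
    using i by (auto simp: leafset_def cat_adj_def)
  ultimately have "game_le (pos (cat_adj n) (verts n - {LA i} - {VB} - nb (cat_adj n) VB)
      (verts n - {LA i} - nb (cat_adj n) (LA i) - {VB})) (pos (cat_adj n) ?P ?Q)"
    by (intro pos_mono) auto
  moreover have "game_le (pos (cat_adj n) ?P ?Q) (num (- int n) True)"
    by (rule leafset_cold(1)[of "{1..n+1} - {i}" "{}" "{1..n+1}" "{1..n+1} - {i}" "{1..n}" "{1..n+1}"])
      (use i in auto)
  moreover have "game_le (num (- int n) True) (num 0 (odd n))" using n by simp
  ultimately show "game_le (pos (cat_adj n) (verts n - {LA i} - {VB} - nb (cat_adj n) VB)
      (verts n - {LA i} - nb (cat_adj n) (LA i) - {VB})) (num 0 (odd n))"
    using game_le_trans by blast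
qed (use assms in \<open>auto simp: cat_adj_def\<close>)

lemma after_LC_le_A2:
  assumes n: "n \<ge> 1" and i: "i \<in> {1..n+1}"
  shows "game_le (after1 n (LC i)) (A2 n)"
proof (intro after1_le_A2 not_le_pos[of _ _ VB])
  let ?P = "leafset {1..n+1} {} ({1..n+1} - {i})" and ?Q = "leafset {1..n+1} {1..n} ({1..n+1} - {i})"
  have "verts n - {LC i} - {VB} - nb (cat_adj n) VB = ?P"
    by (rule cvert_set_eqI) (auto simp: cat_adj_def)
  moreover have "?Q \<subseteq> verts n - {LC i} - nb (cat_adj n) (LC i) - {VB}"
    using i by (auto simp: leafset_def cat_adj_def)
  ultimately have "game_le (pos (cat_adj n) (verts n - {LC i} - {VB} - nb (cat_adj n) VB)
      (verts n - {LC i} - nb (cat_adj n) (LC i) - {VB})) (pos (cat_adj n) ?P ?Q)"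
    by (intro pos_mono) auto
  moreover have "game_le (pos (cat_adj n) ?P ?Q) (num (- int n) True)"
    by (rule leafset_cold(1)[of "{1..n+1}" "{}" "{1..n+1} - {i}" "{1..n+1}" "{1..n}" "{1..n+1} - {i}"])
      (use i in auto)
  moreover have "game_le (num (- int n) True) (num 0 (odd n))" using n by simp
  ultimately show "game_le (pos (cat_adj n) (verts n - {LC i} - {VB} - nb (cat_adj n) VB)
      (verts n - {LC i} - nb (cat_adj n) (LC i) - {VB})) (num 0 (odd n))"
    using game_le_trans by blast
qed (use assms in \<open>auto simp: cat_adj_def\<close>)

text \<open>Any second Left move leaves the star at a or at c untouched, and a reply there is worth
  at most 2n+1+s(n). \<open>A1 n\<close> has a Right option only for odd n, hence the condition on
  \<open>reply\<close>.\<close>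

lemma after1_le_A1:
  assumes n: "n \<ge> 1" and u: "u \<in> insert VB (leaves n VB)"
    and reply: "odd n \<Longrightarrow> \<not> game_le (num (2 * int n + 1) False) (after1 n u)"
  shows "game_le (after1 n u) (A1 n)"
proof (rule pos_leI)
  fix v assume v: "v \<in> verts n - {u}"
  have "\<exists>z\<in>{VA, VC}. {u, v} \<inter> insert z (leaves n z) = {}"
    using u by (cases v) (auto simp: leaves_def)
  then obtain z where z: "z \<in> {VA, VC}" "{u, v} \<inter> insert z (leaves n z) = {}" by blast
  moreover have "card (leaves n z) = n + 1"
    using z by (auto simp: leaves_def card_image inj_on_def)
  ultimately show "\<not> game_le (A1 n) (after2 n u v)"
    using n u v by (intro after2_star_reply[of n u v z]) (auto simp: A1_def leaves_def)
qed (use reply in \<open>auto simp: A1_def split: if_splits\<close>)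

text \<open>Right's reply c leaves Left only a, its n+1 leaves and n-1 leaves of b.\<close>

lemma after_LB_le_A1:
  assumes n: "n \<ge> 1" and i: "i \<in> {1..n}"
  shows "game_le (after1 n (LB i)) (A1 n)"
proof (intro after1_le_A1 not_le_pos[of _ _ VC])
  let ?P = "verts n - {LB i} - {VC} - nb (cat_adj n) VC"
  have "?P = insert VA (leafset {1..n+1} ({1..n} - {i}) {})"
    by (rule cvert_set_eqI) (auto simp: cat_adj_def)
  then have "int (card ?P) \<le> 2 * int n + 1" using i n by simp
  then show "game_le (pos (cat_adj n) ?P (verts n - {LB i} - nb (cat_adj n) (LB i) - {VC}))
      (num (2 * int n + 1) False)"
    by (intro pos_le_card) auto
qed (use assms in \<open>auto simp: cat_adj_def leaves_def\<close>)

lemma after_VB_le_A1: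
  assumes n: "n \<ge> 1"
  shows "game_le (after1 n VB) (A1 n)"
proof (intro after1_le_A1 not_le_pos[of _ _ "LA 1"])
  assume odd: "odd n"
  let ?P = "verts n - {VB} - {LA 1} - nb (cat_adj n) (LA 1)"
    and ?Q = "verts n - {VB} - nb (cat_adj n) VB - {LA 1}"
  have P: "?P = insert VC (leafset ({1..n+1} - {1}) {1..n} {1..n+1})"
    and Q: "?Q = leafset ({1..n+1} - {1}) {} {1..n+1}"
    by (rule cvert_set_eqI; auto simp: cat_adj_def)+
  show "game_le (pos (cat_adj n) ?P ?Q) (num (2 * int n + 1) False)"
  proof (rule pos_leI)
    fix v assume v: "v \<in> ?P"
    show "\<not> game_le (num (2 * int n + 1) False)
      (pos (cat_adj n) (?P - {v}) (?Q - {v} - nb (cat_adj n) v))"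
    proof (cases "v = VC")
      case True
      \<comment> \<open>Right spends another leaf of a. The n-1 common leaves that remain are even
        in number, so no star is left beside 2n+1.\<close>
      show ?thesis unfolding P Q True
        by (intro not_le_pos[of _ _ "LA 2"] leafset_cold(1)[of
              "{1..n+1} - {1} - {2}" "{1..n}" "{1..n+1}" "{1..n+1} - {1} - {2}" "{}" "{}"])
          (use n odd in \<open>auto simp: cat_adj_def\<close>)
    next
      case False
      \<comment> \<open>Otherwise Right plays a leaf of c other than \<open>v\<close>: c dies and
        Left keeps at most 2n private leaves, those of a and b.\<close>
      let ?L = "leafset {} {} {1..n+1} - {v}"
      have ne: "LC 1 \<in> ?L \<or> LC 2 \<in> ?L" using n by auto
      have sub: "?L \<subseteq> ?P - {v}" "?L \<subseteq> ?Q - {v} - nb (cat_adj n) v"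
        using False v by (cases v; auto simp: leafset_def cat_adj_def)+
      have adj: "(cat_adj n l u \<longleftrightarrow> u = VC) \<and> (cat_adj n u l \<longleftrightarrow> u = VC)" if "l \<in> ?L" for l u
        using that by (cases l; cases u) (auto simp: cat_adj_def)
      have "card (?P - {v} - insert VC ?L) \<le> card (leafset ({1..n+1} - {1}) {1..n} {})"
        unfolding P by (intro card_mono) (auto simp: leafset_def)
      then have le: "game_le (num (int (card (?P - {v} - insert VC ?L))) (even (card ?L)))
          (num (2 * int n + 1) False)"
        by simp
      have fin: "finite (?P - {v})" "finite (?Q - {v} - nb (cat_adj n) v)" by simp_all
      have "?L \<noteq> {}" using ne by blast
      moreover have "VC \<notin> ?L" by simp
      ultimately show ?thesis by (rule star_reply[OF fin sub _ _ _ le]) (rule adj)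
    qed
  qed auto
qed (use assms in \<open>auto simp: cat_adj_def\<close>)

section \<open>Openings attaining the two bounds\<close>

lemma A1_le_after_VB: "game_le (A1 n) (after1 n VB)"
proof (rule le_posI)
  let ?P = "verts n - {VB}" and ?Q = "verts n - {VB} - nb (cat_adj n) VB"
  fix v assume v: "v \<in> ?Q"
  show "\<not> game_le (pos (cat_adj n) (?P - {v} - nb (cat_adj n) v) (?Q - {v})) (A1 n)"
  proof (cases v)
    case (LA i)
    \<comment> \<open>Left takes the opposite outer centre: 2n+1 leaves are private and the other n
      leaves of the attacked star are common.\<close>
    with v show ?thesis unfolding A1_def
      by (intro not_pos_le[of _ _ VC] leafset_cold(2)[of
            "{1..n+1} - {i}" "{1..n}" "{1..n+1}" "{1..n+1} - {i}" "{}" "{}"])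
        (auto simp: cat_adj_def)
  next
    case (LC i)
    with v show ?thesis unfolding A1_def
      by (intro not_pos_le[of _ _ VA] leafset_cold(2)[of
            "{1..n+1}" "{1..n}" "{1..n+1} - {i}" "{}" "{}" "{1..n+1} - {i}"])
        (auto simp: cat_adj_def)
  qed (use v in \<open>auto simp: cat_adj_def\<close>)
next
  fix h assume h: "h \<in> set (lopts (A1 n))"
  \<comment> \<open>Left's second move is a; c is dropped from Left's set for a lower bound
    consisting of leaves, of which n+1 are common.\<close>
  let ?P = "leafset {1..n+1} {1..n} {1..n+1}" and ?Q = "leafset {} {} {1..n+1}"
  have "game_le h (num (2 * int n + 1) (even n))"
    using h by (auto simp: A1_def split: if_splits)
  moreover have "game_le (num (2 * int n + 1) (even n)) (pos (cat_adj n) ?P ?Q)"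
    by (rule leafset_cold(2)[of "{1..n+1}" "{1..n}" "{1..n+1}" "{}" "{}" "{1..n+1}"]) auto
  moreover have "game_le (pos (cat_adj n) ?P ?Q) (after2 n VB VA)"
    by (rule pos_mono) (auto simp: leafset_def cat_adj_def verts_eq)
  ultimately have "game_le h (after2 n VB VA)" using game_le_trans by blast
  then show "\<not> game_le (after1 n VB) h" by (intro not_pos_le[of _ _ VA]) auto
qed auto

text \<open>Right meets the threat at once by moving to this very number. The bound serves the line
  a, leaf of b, c.\<close>

lemma A2_le_num: "game_le (A2 n) (num (2 * int n + 2) (even n))"
proof -
  have "\<not> game_le (num (2 * int n + 2) (even n)) (threat n)"
    by (rule not_game_le_ropt[of "num (2 * int n + 2) (even n)"]) (simp_all add: threat_def)
  moreover have "\<not> game_le (num (2 * int n + 2) False) (A2 n)"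
    by (rule not_game_le_ropt[of "num 0 (odd n)"]) (simp_all add: A2_def)
  ultimately show ?thesis
    by (subst game_le_iff) (auto simp: A2_def)
qed

lemma threat_le_after2: "game_le (threat n) (after2 n VA VC)"
proof (rule le_posI)
  let ?P = "verts n - {VA} - {VC}"
    and ?Q = "verts n - {VA} - nb (cat_adj n) VA - {VC} - nb (cat_adj n) VC"
  fix v assume "v \<in> ?Q"
  then obtain j where v: "v = LB j" "j \<in> {1..n}" by (cases v) (auto simp: cat_adj_def)
  show "\<not> game_le (pos (cat_adj n) (?P - {v} - nb (cat_adj n) v) (?Q - {v})) (threat n)"
    by (intro not_game_le_ropt[of "num (2 * int n + 2) (even n)"] leafset_cold(2)[of
          "{1..n+1}" "{1..n} - {j}" "{1..n+1}" "{}" "{1..n} - {j}" "{}"])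
      (use v in \<open>auto simp: cat_adj_def threat_def\<close>)
next
  fix h assume "h \<in> set (lopts (threat n))"
  then have h: "h = num (3 * int n + 2) False" by (simp add: threat_def)
  show "\<not> game_le (after2 n VA VC) h" unfolding h
    by (intro not_pos_le[of _ _ VB] leafset_cold(2)[of "{1..n+1}" "{1..n}" "{1..n+1}" "{}" "{}" "{}"])
      (auto simp: cat_adj_def)
qed auto

text \<open>The position after Left's a and Right's leaf \<open>i\<close> of c: b is open to Left
  only and c to Right only. If Right takes c, the value is still 1+s(n); a leaf of b is answered by
  a leaf of c, which kills c, and a leaf of c is answered by b.\<close>

lemma num_zero_le_fork:
  assumes n: "n \<ge> 1" and i: "i \<in> {1..n+1}"
    and P: "P = insert VB (leafset {1..n+1} {1..n} ({1..n+1} - {i}))"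
    and Q: "Q = insert VC (leafset {} {1..n} ({1..n+1} - {i}))"
  shows "game_le (num 0 (odd n)) (pos (cat_adj n) P Q)"
proof (rule le_posI)
  fix w assume w: "w \<in> Q"
  show "\<not> game_le (pos (cat_adj n) (P - {w} - nb (cat_adj n) w) (Q - {w})) (num 0 (odd n))"
  proof (cases w)
    case VC
    have "game_le (num 1 (odd n)) (pos (cat_adj n) (P - {w} - nb (cat_adj n) w) (Q - {w}))"
      unfolding VC
      by (rule leafset_cold(2)[of "{1..n+1}" "{1..n}" "{}" "{}" "{1..n}" "{1..n+1} - {i}"])
        (use i in \<open>auto simp: cat_adj_def P Q\<close>)
    moreover have "\<not> game_le (num 1 (odd n)) (num 0 (odd n))" by simp
    ultimately show ?thesis using game_le_trans by blast
  next
    case (LB j)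
    then have j: "j \<in> {1..n}" using w Q by auto
    \<comment> \<open>Any second leaf of c; it exists because n is at least 1.\<close>
    define k where "k = (if i = 1 then 2 else 1 :: nat)"
    have k: "k \<in> {1..n+1}" "k \<noteq> i" using n by (auto simp: k_def)
    let ?p = "pos (cat_adj n) (P - {w} - nb (cat_adj n) w - {LC k})
      (Q - {w} - {LC k} - nb (cat_adj n) (LC k))"
    have "game_le (num (int n + 1) False) ?p"
      unfolding LB
      by (rule leafset_cold(2)[of "{1..n+1}" "{1..n} - {j}" "{1..n+1} - {i} - {k}"
            "{}" "{1..n} - {j}" "{1..n+1} - {i} - {k}"])
        (use i j k n in \<open>auto simp: cat_adj_def P Q\<close>)
    moreover have "game_le (num 0 (odd n)) (num (int n + 1) False)" by simp
    ultimately have "game_le (num 0 (odd n)) ?p" by (rule game_le_trans[rotated])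
    then show ?thesis
      by (rule not_pos_le[rotated 3]) (use LB k in \<open>auto simp: cat_adj_def P Q\<close>)
  next
    case (LC k)
    then have k: "k \<in> {1..n+1}" "k \<noteq> i" using w Q by auto
    let ?p = "pos (cat_adj n) (P - {w} - nb (cat_adj n) w - {VB})
      (Q - {w} - {VB} - nb (cat_adj n) VB)"
    have "game_le (num (2 * int n + 1) (even n)) ?p"
      unfolding LC
      by (rule leafset_cold(2)[of "{1..n+1}" "{1..n}" "{1..n+1} - {i} - {k}"
            "{}" "{}" "{1..n+1} - {i} - {k}"])
        (use i k n in \<open>auto simp: cat_adj_def P Q\<close>)
    moreover have "game_le (num 0 (odd n)) (num (2 * int n + 1) (even n))" by simp
    ultimately have "game_le (num 0 (odd n)) ?p" by (rule game_le_trans[rotated])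
    then show ?thesis
      by (rule not_pos_le[rotated 3]) (use LC in \<open>auto simp: cat_adj_def P Q\<close>)
  qed (use w Q in auto)
next
  fix h assume "h \<in> set (lopts (num 0 (odd n)))"
  then have "game_le h (num (2 * int n + 1) (odd n))" by (auto split: if_splits)
  moreover have "game_le (num (2 * int n + 1) (odd n))
      (pos (cat_adj n) (P - {VB}) (Q - {VB} - nb (cat_adj n) VB))"
    by (rule leafset_cold(2)[of "{1..n+1}" "{1..n}" "{1..n+1} - {i}" "{}" "{}" "{1..n+1} - {i}"])
      (use i n in \<open>auto simp: cat_adj_def P Q\<close>)
  ultimately have "game_le h (pos (cat_adj n) (P - {VB}) (Q - {VB} - nb (cat_adj n) VB))"
    by (rule game_le_trans)
  then show "\<not> game_le (pos (cat_adj n) P Q) h"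
    by (rule not_pos_le[rotated 3]) (auto simp: P Q)
qed (auto simp: P Q)

text \<open>Right's c reaches exactly s(n), a leaf of b is met by Left's c, and a leaf of c leads to
  the fork. Left's own c carries out the threat.\<close>

lemma A2_le_after_VA:
  assumes n: "n \<ge> 1"
  shows "game_le (A2 n) (after1 n VA)"
proof (rule le_posI)
  let ?P = "verts n - {VA}" and ?Q = "verts n - {VA} - nb (cat_adj n) VA"
  fix v assume v: "v \<in> ?Q"
  show "\<not> game_le (pos (cat_adj n) (?P - {v} - nb (cat_adj n) v) (?Q - {v})) (A2 n)"
  proof (cases v)
    case VC
    show ?thesis unfolding VC
      by (intro not_game_le_ropt[of "num 0 (odd n)"] leafset_cold(2)[of
            "{1..n+1}" "{1..n}" "{}" "{}" "{1..n}" "{1..n+1}"])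
        (auto simp: cat_adj_def A2_def)
  next
    case (LB j)
    let ?p = "pos (cat_adj n) (?P - {v} - nb (cat_adj n) v - {VC})
      (?Q - {v} - {VC} - nb (cat_adj n) VC)"
    have "game_le (num (2 * int n + 2) (even n)) ?p"
      unfolding LB
      by (rule leafset_cold(2)[of "{1..n+1}" "{1..n} - {j}" "{1..n+1}" "{}" "{1..n} - {j}" "{}"])
        (use v LB n in \<open>auto simp: cat_adj_def\<close>)
    with A2_le_num have "game_le (A2 n) ?p" by (rule game_le_trans)
    then show ?thesis
      by (rule not_pos_le[rotated 3]) (use LB in \<open>auto simp: cat_adj_def\<close>)
  next
    case (LC i)
    then have i: "i \<in> {1..n+1}" using v by simp
    have "?P - {v} - nb (cat_adj n) v = insert VB (leafset {1..n+1} {1..n} ({1..n+1} - {i}))"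
      "?Q - {v} = insert VC (leafset {} {1..n} ({1..n+1} - {i}))"
      unfolding LC by (rule cvert_set_eqI; use i in \<open>auto simp: cat_adj_def\<close>)+
    with n i have "game_le (num 0 (odd n))
        (pos (cat_adj n) (?P - {v} - nb (cat_adj n) v) (?Q - {v}))"
      by (intro num_zero_le_fork)
    then show ?thesis
      by (intro not_game_le_ropt[of "num 0 (odd n)"]) (auto simp: A2_def)
  qed (use v in \<open>auto simp: cat_adj_def\<close>)
next
  fix h assume "h \<in> set (lopts (A2 n))"
  then show "\<not> game_le (after1 n VA) h"
    using threat_le_after2 by (intro not_pos_le[of _ _ VC]) (auto simp: A2_def)
qed auto

section \<open>Canonicity of the claimed form\<close>

lemma game_le_switch:
  "game_le l l' \<Longrightarrow> game_le r r' \<Longrightarrow> game_le (Game [l] [r]) (Game [l'] [r'])"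
  using not_game_le_lopt[of l' "Game [l'] [r']" l] not_game_le_ropt[of r "Game [l] [r]" r']
  by (subst game_le_iff) simp

lemma s_game_eq_num: "s_game n = num 0 (odd n)"
  by (simp add: s_game_def num_def gint_def game_star_def)

lemma canonical_game_nat: "canonical (game_nat m)"
  by (induction m) (simp_all add: game_zero_def)

lemma canonical_num: "k \<ge> 0 \<Longrightarrow> canonical (num k e)"
proof (induction e)
  case False
  then show ?case by (simp add: num_def gint_def canonical_game_nat)
next
  case True
  then have "canonical (num k False)" by (simp add: num_def gint_def canonical_game_nat)
  with True show ?case by (subst canonical_iff) simp
qed

lemma canonical_threat: "canonical (threat n)"
proof -
  \<comment> \<open>Covers the Left option of the Right option: 2n+2 if that one has a star, 2n+1
    otherwise.\<close>
  have "\<not> game_le (threat n) (num k False)" if "k \<le> 2 * int n + 2" for k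
    using that by (intro not_game_le_lopt[of "num (3 * int n + 2) False"]) (auto simp: threat_def)
  then show ?thesis
    by (subst canonical_iff) (auto simp: canonical_num)
qed

lemma num_le_threat: "k \<le> 2 * int n + 1 \<Longrightarrow> k \<ge> 0 \<Longrightarrow> game_le (num k e) (threat n)"
  using not_game_le_lopt[of "num (3 * int n + 2) False" "threat n" "num k False"]
    not_game_le_lopt[of "num (3 * int n + 2) False" "threat n" "num (k - 1) False"]
  by (subst game_le_iff) (auto simp: threat_def)

text \<open>Neither option reverses: Right can go from \<open>A2 n\<close> to s(n), well below 2n+2,
  and Left can go to \<open>threat n\<close>, which is at least 0.\<close>

lemma canonical_A2: "canonical (A2 n)"
proof -
  have "\<not> game_le (num (2 * int n + 2) (even n)) (A2 n)"
    by (rule not_game_le_ropt[of "num 0 (odd n)"]) (simp_all add: A2_def)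
  moreover have "\<not> game_le (A2 n) (num 0 False)"
    using num_le_threat[of 0 n False]
    by (intro not_game_le_lopt[of "threat n"]) (simp_all add: A2_def)
  ultimately show ?thesis
    by (subst canonical_iff) (auto simp: canonical_threat canonical_num)
qed

text \<open>The first mover in \<open>A2 n\<close> decides: Right drops to s(n), below
  \<open>A1 n\<close>, while Left rises to a threat of at least \<open>A1 n\<close>. So neither
  option dominates the other.\<close>

lemma not_A1_le_A2: "\<not> game_le (A1 n) (A2 n)"
  by (rule not_game_le_ropt[of "num 0 (odd n)"]) (simp_all add: A2_def A1_def)

lemma not_A2_le_A1: "\<not> game_le (A2 n) (A1 n)"
  by (rule not_game_le_lopt[of "threat n"]) (simp_all add: A2_def A1_def num_le_threat)

text \<open>The game is its own negative, so the conditions on its Right options mirror those on its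
  Left options.\<close>

lemma canonical_pm:
  assumes "canonical a" "canonical b" "\<not> game_le a b" "\<not> game_le b a"
    and "\<And>y. y \<in> set (ropts a) \<union> set (ropts b) \<Longrightarrow>
      \<not> game_le y (Game [a, b] [game_neg a, game_neg b])"
  shows "canonical (Game [a, b] [game_neg a, game_neg b])"
proof -
  let ?K = "Game [a, b] [game_neg a, game_neg b]"
  have K: "game_neg ?K = ?K" by simp
  have rev: "\<not> game_le ?K (game_neg y)" if "y \<in> set (ropts a) \<union> set (ropts b)" for y
    using assms(5)[OF that] K game_le_neg by metis
  have two: "(i < Suc (Suc 0)) = (i = 0 \<or> i = 1)" for i by auto
  show ?thesis
    using assms rev by (subst canonical_iff) (auto simp: canonical_neg two simp del: game_le.simps)
qed

lemma canonical_K: "canonical (Game [A1 n, A2 n] [game_neg (A1 n), game_neg (A2 n)])"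
proof (rule canonical_pm)
  fix y assume "y \<in> set (ropts (A1 n)) \<union> set (ropts (A2 n))"
  \<comment> \<open>These Right options are 2n+1 or s(n), both above -(2n+1)+s(n), to which Right
    can move.\<close>
  then have "game_le (game_neg (A1 n)) y"
    by (auto simp: A1_def A2_def game_neg_num split: if_splits)
  then show "\<not> game_le y (Game [A1 n, A2 n] [game_neg (A1 n), game_neg (A2 n)])"
    by (intro not_game_le_ropt[of "game_neg (A1 n)"]) simp_all
qed (simp_all add: not_A1_le_A2 not_A2_le_A1 canonical_A2, simp add: A1_def canonical_num)

section \<open>The starting position against the canonical form\<close>

lemma after1_le_option:
  assumes "n \<ge> 1" "u \<in> verts n"
  shows "game_le (after1 n u) (A1 n) \<or> game_le (after1 n u) (A2 n)"
  using assms after_VA_le_A2 after_VC_le_A2 after_LA_le_A2 after_LC_le_A2 after_LB_le_A1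
    after_VB_le_A1
  by (cases u) simp_all

lemma snort_le_K:
  assumes n: "n \<ge> 1"
  shows "game_le (pos (cat_adj n) (verts n) (verts n))
    (Game [A1 n, A2 n] [game_neg (A1 n), game_neg (A2 n)])" (is "game_le ?G ?K")
proof (rule pos_leI)
  fix u assume "u \<in> verts n"
  then show "\<not> game_le ?K (after1 n u)"
    using after1_le_option[OF n] not_game_le_lopt[of _ ?K] by fastforce
next
  fix h assume "h \<in> set (ropts ?K)"
  then consider "h = game_neg (A1 n)" | "h = game_neg (A2 n)" by auto
  \<comment> \<open>Right's openings are the negatives of Left's, so b and a supply the two Right
    options.\<close>
  then have "\<exists>u\<in>verts n. game_le (game_neg (after1 n u)) h"
    using A1_le_after_VB[of n] A2_le_after_VA[OF n] by cases (simp, metis mem_verts(1,2))+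
  then obtain u where "u \<in> verts n" "game_le (game_neg (after1 n u)) h" by blast
  then show "\<not> game_le h ?G"
    by (intro not_le_pos[of _ _ u]) (simp_all add: pos_neg Diff_eq Int_assoc Int_commute)
qed auto

theorem theorem8:
  fixes n :: nat
  assumes "n \<ge> 1"
  shows "\<exists>K. canonical_form_of (snort_caterpillar n) K \<and>
    (\<exists>A1 A2. K = Game [A1, A2] [game_neg A1, game_neg A2]
       \<and> game_eq A1 (game_plus (game_nat (2*n+1)) (s_game n))
       \<and> game_eq A2 (Game [Game [game_nat (3*n+2)] [game_plus (game_nat (2*n+2)) (s_game (n-1))]]
                          [s_game n]))"
proof (intro exI conjI)
  let ?K = "Game [A1 n, A2 n] [game_neg (A1 n), game_neg (A2 n)]"
  let ?G = "snort_caterpillar n" and ?p = "pos (cat_adj n) (verts n) (verts n)"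
  have G: "?G = tinted (cat_adj n) (cat_vertices n) (cat_vertices n)"
    by (simp add: snort_caterpillar_def snort_eq_tinted)
  have "game_le ?G ?K"
    unfolding G by (rule game_le_trans[OF tinted_le_pos snort_le_K[OF assms]])
  \<comment> \<open>Both games equal their own negatives, so negating the first inequality reverses
    it.\<close>
  moreover from this have "game_le ?K ?G"
    using game_le_neg[of ?K ?G] by (simp add: G tinted_neg del: game_le.simps)
  ultimately show "canonical_form_of ?G ?K"
    using canonical_K by (simp add: canonical_form_of_def game_eq_def del: canonical.simps)
  show "?K = Game [A1 n, A2 n] [game_neg (A1 n), game_neg (A2 n)]" ..
  show "game_eq (A1 n) (game_plus (game_nat (2*n+1)) (s_game n))"
    using game_eq_plus_s_game[of "2*n+1" n] by (simp add: A1_def add.commute)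
  \<comment> \<open>Since n is at least 1, n-1 is odd exactly when n is even.\<close>
  have "game_eq (num (2 * int n + 2) (even n)) (game_plus (game_nat (2*n+2)) (s_game (n-1)))"
    using game_eq_plus_s_game[of "2*n+2" "n-1"] assms by (simp add: add.commute)
  moreover have "num (3 * int n + 2) False = game_nat (3*n+2)"
    using num_of_nat[of "3*n+2"] by (simp add: add.commute)
  ultimately show "game_eq (A2 n)
      (Game [Game [game_nat (3*n+2)] [game_plus (game_nat (2*n+2)) (s_game (n-1))]] [s_game n])"
    unfolding game_eq_def A2_def threat_def s_game_eq_num
    by (metis game_le_switch game_le_refl)
qed

end
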